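(* Let $\bar{x}$ be a feasible point of the problem (NSOCP), and for unit vectors $\bar{w}_j\in\mathbb{R}^{m_j-1}$, $j\in I_0(\bar{x})$, consider the family of vectors $$\left\{Dg_{j}(\bar{x})^\top u_1(g_{j}(\bar{x}))\right\}_{j\in I_B(\bar{x})}\ \bigcup\ \left\{ Dg_{j}(\bar{x})^\top (1,-\bar{w}_{j}),\ Dg_{j}(\bar{x})^\top (1,\bar{w}_{j}) \right\}_{j\in I_0(\bar{x})}. \qquad ( * )$$ Then: 1. Nondegeneracy holds at $\bar{x}$ if, and only if, the family $( * )$ is linearly independent for every choice of $\bar{w}_{j}\in \mathbb{R}^{m_j-1}$ with $\|\bar{w}_{j}\|=1$, $j\in I_0(\bar{x})$. 2. Robinson's CQ holds at $\bar{x}$ if, and only if, the family $( * )$ is positively linearly independent for every choice of $\bar{w}_{j}\in \mathbb{R}^{m_j-1}$ with $\|\bar{w}_{j}\|=1$, $j\in I_0(\bar{x})$.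
   Context: Norms are Euclidean. For $m\ge 2$ write $y=(y_0,\widehat{y})\in\mathbb{R}\times\mathbb{R}^{m-1}$, and let $\mathbb{L}_m=\{y\in\mathbb{R}^m: y_0\ge\|\widehat{y}\|\}$ be the second-order cone. Let $\mathrm{bd}_+\mathbb{L}_m$ be its boundary minus the origin and $\mathrm{int}\,\mathbb{L}_m$ its interior. Problem (NSOCP): minimize $f(x)$ over $x\in\mathbb{R}^n$ subject to $g_j(x)\in\mathbb{L}_{m_j}$, $j=1,\dots,q$, where $f:\mathbb{R}^n\to\mathbb{R}$ and $g_j=(g_{j,0},\widehat{g}_j):\mathbb{R}^n\to\mathbb{R}^{m_j}$ are continuously differentiable and $m_j\ge 2$ for all $j$. $D$ denotes the Jacobian matrix. For feasible $x$: $I_0(x)=\{j: g_j(x)=0\}$, $I_B(x)=\{j: g_j(x)\in\mathrm{bd}_+\mathbb{L}_{m_j}\}$. For $y$ with $\widehat{y}\neq 0$: $u_1(y)=\frac12\left(1,-\widehat{y}/\|\widehat{y}\|\right)$. Let $\Gamma_j=\begin{bmatrix}1&0\\0&-\mathbb{I}_{m_j-1}\end{bmatrix}$, where $\mathbb{I}_{m_j-1}$ is the identity matrix. Consider the equation $$\sum_{j\in I_B(\bar{x})}a_j\,Dg_j(\bar{x})^\top\Gamma_j g_j(\bar{x})+\sum_{j\in I_0(\bar{x})}Dg_j(\bar{x})^\top v_j=0 .\qquad (E)$$ Nondegeneracy holds at $\bar{x}$ if the only solution of $(E)$ with $a_j\in\mathbb{R}$ and $v_j\in\mathbb{R}^{m_j}$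 is $a_j=0$, $v_j=0$ for all $j$. Robinson's CQ holds at $\bar{x}$ if the only solution of $(E)$ with $a_j\ge0$ and $v_j\in\mathbb{L}_{m_j}$ is $a_j=0$, $v_j=0$ for all $j$. A finite (indexed) family of vectors is positively linearly independent if no linear combination of it with nonnegative coefficients, not all zero, vanishes. *)

theory Defs
  imports "HOL-Analysis.Analysis"
begin

text \<open>
  The dimensions \<open>m j\<close> of the constraint blocks vary with \<open>j\<close>, so \<open>\<real>\<^sup>m\<close> is rendered as the carrier
  of the library topology \<^const>\<open>Euclidean_space\<close>: functions \<open>nat \<Rightarrow> real\<close> vanishing from index
  \<open>m\<close> on. Two elements are equal as functions iff all their \<open>m\<close> coordinates agree, and the zero
  vector is \<open>\<lambda>_. 0\<close>. The space \<open>\<real>\<^sup>n\<close> of decision variables is \<^typ>\<open>real^'n\<close>.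
\<close>

abbreviation Rvec :: "nat \<Rightarrow> (nat \<Rightarrow> real) set"
  where "Rvec m \<equiv> topspace (Euclidean_space m)"

abbreviation enorm :: "nat \<Rightarrow> (nat \<Rightarrow> real) \<Rightarrow> real"
  where "enorm m y \<equiv> L2_set y {..<m}"

text \<open>The block vector \<open>(s, w)\<close> is \<^term>\<open>case_nat s w\<close>; conversely \<open>y = (y 0, hat y)\<close>.\<close>

definition hat :: "(nat \<Rightarrow> real) \<Rightarrow> nat \<Rightarrow> real"
  where "hat y = (\<lambda>i. y (Suc i))"

definition soc :: "nat \<Rightarrow> (nat \<Rightarrow> real) set"
  where "soc m = {y \<in> Rvec m. y 0 \<ge> enorm (m - 1) (hat y)}"

definition bd_plus_soc :: "nat \<Rightarrow> (nat \<Rightarrow> real) set"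
  where "bd_plus_soc m = (Euclidean_space m frontier_of soc m) - {\<lambda>_. 0}"

definition u1 :: "nat \<Rightarrow> (nat \<Rightarrow> real) \<Rightarrow> nat \<Rightarrow> real"
  where "u1 m y = (\<lambda>i. 1/2 * case_nat 1 (\<lambda>k. - (hat y k / enorm (m - 1) (hat y))) i)"

definition Gamma :: "nat \<Rightarrow> nat \<Rightarrow> real"
  where "Gamma i k = (if i \<noteq> k then 0 else if i = 0 then 1 else - 1)"

definition mat_vec :: "nat \<Rightarrow> (nat \<Rightarrow> nat \<Rightarrow> real) \<Rightarrow> (nat \<Rightarrow> real) \<Rightarrow> nat \<Rightarrow> real"
  where "mat_vec m A y = (\<lambda>i. if i < m then \<Sum>k<m. A i k * y k else 0)"

definition continuously_differentiable :: "(real^'n \<Rightarrow> real) \<Rightarrow> bool"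
  where "continuously_differentiable f \<longleftrightarrow>
    (\<exists>f' :: real^'n \<Rightarrow> (real^'n) \<Rightarrow>\<^sub>L real.
      (\<forall>x. (f has_derivative blinfun_apply (f' x)) (at x)) \<and> continuous_on UNIV f')"

text \<open>Entry \<open>(i, k)\<close> of the Jacobian is the partial derivative of component \<open>i\<close> in direction \<open>k\<close>.\<close>

definition Jac :: "(real^'n \<Rightarrow> nat \<Rightarrow> real) \<Rightarrow> real^'n \<Rightarrow> nat \<Rightarrow> 'n \<Rightarrow> real"
  where "Jac h x i k = frechet_derivative (\<lambda>z. h z i) (at x) (axis k 1)"

definition JacT_vec :: "nat \<Rightarrow> (real^'n \<Rightarrow> nat \<Rightarrow> real) \<Rightarrow> real^'n \<Rightarrow> (nat \<Rightarrow> real) \<Rightarrow> real^'n"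
  where "JacT_vec m h x v = (\<chi> k. \<Sum>i<m. Jac h x i k * v i)"

text \<open>The data of (NSOCP): objective \<open>f\<close> and constraints \<open>g j x \<in> soc (m j)\<close> for \<open>j \<in> {1..q}\<close>.\<close>

definition nsocp ::
  "(real^'n \<Rightarrow> real) \<Rightarrow> nat \<Rightarrow> (nat \<Rightarrow> nat) \<Rightarrow> (nat \<Rightarrow> real^'n \<Rightarrow> nat \<Rightarrow> real) \<Rightarrow> bool"
  where "nsocp f q m g \<longleftrightarrow>
    continuously_differentiable f \<and>
    (\<forall>j\<in>{1..q}. m j \<ge> 2 \<and> (\<forall>x. g j x \<in> Rvec (m j)) \<and>
       (\<forall>i<m j. continuously_differentiable (\<lambda>x. g j x i)))"

definition feasible ::
  "nat \<Rightarrow> (nat \<Rightarrow> nat) \<Rightarrow> (nat \<Rightarrow> real^'n \<Rightarrow> nat \<Rightarrow> real) \<Rightarrow> real^'n \<Rightarrow> bool"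
  where "feasible q m g x \<longleftrightarrow> (\<forall>j\<in>{1..q}. g j x \<in> soc (m j))"

definition I0 :: "nat \<Rightarrow> (nat \<Rightarrow> real^'n \<Rightarrow> nat \<Rightarrow> real) \<Rightarrow> real^'n \<Rightarrow> nat set"
  where "I0 q g x = {j \<in> {1..q}. g j x = (\<lambda>_. 0)}"

definition IB ::
  "nat \<Rightarrow> (nat \<Rightarrow> nat) \<Rightarrow> (nat \<Rightarrow> real^'n \<Rightarrow> nat \<Rightarrow> real) \<Rightarrow> real^'n \<Rightarrow> nat set"
  where "IB q m g x = {j \<in> {1..q}. g j x \<in> bd_plus_soc (m j)}"

definition equation_E ::
  "nat \<Rightarrow> (nat \<Rightarrow> nat) \<Rightarrow> (nat \<Rightarrow> real^'n \<Rightarrow> nat \<Rightarrow> real) \<Rightarrow> real^'n \<Rightarrow>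
    (nat \<Rightarrow> real) \<Rightarrow> (nat \<Rightarrow> nat \<Rightarrow> real) \<Rightarrow> bool"
  where "equation_E q m g x a v \<longleftrightarrow>
    (\<Sum>j\<in>IB q m g x. a j *\<^sub>R JacT_vec (m j) (g j) x (mat_vec (m j) Gamma (g j x))) +
    (\<Sum>j\<in>I0 q g x. JacT_vec (m j) (g j) x (v j)) = 0"

definition nondegenerate ::
  "nat \<Rightarrow> (nat \<Rightarrow> nat) \<Rightarrow> (nat \<Rightarrow> real^'n \<Rightarrow> nat \<Rightarrow> real) \<Rightarrow> real^'n \<Rightarrow> bool"
  where "nondegenerate q m g x \<longleftrightarrow>
    (\<forall>a v. (\<forall>j\<in>I0 q g x. v j \<in> Rvec (m j)) \<longrightarrow> equation_E q m g x a v \<longrightarrow>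
       (\<forall>j\<in>IB q m g x. a j = 0) \<and> (\<forall>j\<in>I0 q g x. v j = (\<lambda>_. 0)))"

definition robinson_cq ::
  "nat \<Rightarrow> (nat \<Rightarrow> nat) \<Rightarrow> (nat \<Rightarrow> real^'n \<Rightarrow> nat \<Rightarrow> real) \<Rightarrow> real^'n \<Rightarrow> bool"
  where "robinson_cq q m g x \<longleftrightarrow>
    (\<forall>a v. (\<forall>j\<in>IB q m g x. a j \<ge> 0) \<longrightarrow> (\<forall>j\<in>I0 q g x. v j \<in> soc (m j)) \<longrightarrow>
       equation_E q m g x a v \<longrightarrow>
       (\<forall>j\<in>IB q m g x. a j = 0) \<and> (\<forall>j\<in>I0 q g x. v j = (\<lambda>_. 0)))"

text \<open>Families are indexed, so a vector occurring at two indices makes the family dependent.\<close>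

definition lin_indep_family :: "'i set \<Rightarrow> ('i \<Rightarrow> 'a::real_vector) \<Rightarrow> bool"
  where "lin_indep_family I b \<longleftrightarrow>
    (\<forall>c. (\<Sum>i\<in>I. c i *\<^sub>R b i) = 0 \<longrightarrow> (\<forall>i\<in>I. c i = 0))"

definition pos_lin_indep_family :: "'i set \<Rightarrow> ('i \<Rightarrow> 'a::real_vector) \<Rightarrow> bool"
  where "pos_lin_indep_family I b \<longleftrightarrow>
    \<not> (\<exists>c. (\<forall>i\<in>I. c i \<ge> 0) \<and> (\<exists>i\<in>I. c i \<noteq> 0) \<and> (\<Sum>i\<in>I. c i *\<^sub>R b i) = 0)"

text \<open>
  Index set of the family under study: \<open>Bdry j\<close> for \<open>j \<in> IB\<close>, and both \<open>Minus j\<close> (the vector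
  built from \<open>(1, - w j)\<close>) and \<open>Plus j\<close> (built from \<open>(1, w j)\<close>) for \<open>j \<in> I0\<close>.
\<close>

datatype fam_idx = Bdry nat | Minus nat | Plus nat

definition fam_index_set ::
  "nat \<Rightarrow> (nat \<Rightarrow> nat) \<Rightarrow> (nat \<Rightarrow> real^'n \<Rightarrow> nat \<Rightarrow> real) \<Rightarrow> real^'n \<Rightarrow> fam_idx set"
  where "fam_index_set q m g x = Bdry ` IB q m g x \<union> (Minus ` I0 q g x \<union> Plus ` I0 q g x)"

fun fam ::
  "(nat \<Rightarrow> nat) \<Rightarrow> (nat \<Rightarrow> real^'n \<Rightarrow> nat \<Rightarrow> real) \<Rightarrow> real^'n \<Rightarrow> (nat \<Rightarrow> nat \<Rightarrow> real) \<Rightarrow>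
    fam_idx \<Rightarrow> real^'n"
  where
    "fam m g x w (Bdry j) = JacT_vec (m j) (g j) x (u1 (m j) (g j x))"
  | "fam m g x w (Minus j) = JacT_vec (m j) (g j) x (case_nat 1 (\<lambda>i. - w j i))"
  | "fam m g x w (Plus j) = JacT_vec (m j) (g j) x (case_nat 1 (w j))"

definition unit_choice ::
  "nat \<Rightarrow> (nat \<Rightarrow> nat) \<Rightarrow> (nat \<Rightarrow> real^'n \<Rightarrow> nat \<Rightarrow> real) \<Rightarrow> real^'n \<Rightarrow>
    (nat \<Rightarrow> nat \<Rightarrow> real) \<Rightarrow> bool"
  where "unit_choice q m g x w \<longleftrightarrow>
    (\<forall>j\<in>I0 q g x. w j \<in> Rvec (m j - 1) \<and> enorm (m j - 1) (w j) = 1)"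

end

theory Submission
  imports Defs
begin

text \<open>
  Both equivalences are instances of one change of coefficients that turns a vanishing combination
  of the family into a solution of (E) and back.

  For \<open>j \<in> I\<^sub>B\<close> the point \<open>y = g\<^sub>j(x)\<close> satisfies \<open>y\<^sub>0 = \<parallel>hat y\<parallel> > 0\<close>, and there
  \<open>\<Gamma> y = (y\<^sub>0, - hat y) = 2 y\<^sub>0 u\<^sub>1(y)\<close>. The two coefficients attached to \<open>j\<close> therefore differ by
  the positive factor \<open>2 y\<^sub>0\<close>, which preserves vanishing and sign (\<open>Gamma_eq_scaled_u1\<close>).

  For \<open>j \<in> I\<^sub>0\<close> every vector of \<open>\<real>\<^sup>m\<close> is a combination \<open>\<alpha> (1, -w) + \<beta> (1, w)\<close> for some unit
  vector \<open>w\<close>: this is its spectral decomposition, with the tail a multiple of \<open>w\<close> and eigenvalues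
  \<open>2 \<alpha>\<close> and \<open>2 \<beta>\<close>. It lies in the second-order cone iff both coefficients are nonnegative, and it
  vanishes iff both are zero. Since \<open>w\<close> depends on the vector, the family has to be considered for all
  choices of unit vectors.

  Linear independence corresponds to arbitrary real coefficients and vectors of \<open>\<real>\<^sup>m\<close>, positive linear
  independence to nonnegative coefficients and vectors of the cone. The lemma
  \<open>only_trivial_solution_iff\<close> treats an arbitrary set of coefficients \<open>K\<close> and a matching set of
  vectors \<open>C m\<close>; the theorem uses \<open>(UNIV, Rvec)\<close> and \<open>({0..}, soc)\<close>.
\<close>

section \<open>Spectral decomposition with respect to the second-order cone\<close>

lemma enorm_scale: "enorm m (\<lambda>i. r * y i) = \<bar>r\<bar> * enorm m y"
  by (simp add: L2_set_def power_mult_distrib real_sqrt_mult flip: sum_distrib_left)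

lemma hat_in_Rvec: "y \<in> Rvec m \<Longrightarrow> hat y \<in> Rvec (m - 1)"
  by (auto simp: topspace_Euclidean_space hat_def)

lemma enorm_eq_0_iff: "y \<in> Rvec m \<Longrightarrow> enorm m y = 0 \<longleftrightarrow> y = (\<lambda>_. 0)"
  by (auto simp: topspace_Euclidean_space L2_set_eq_0_iff fun_eq_iff)
     (metis lessThan_iff not_le)

text \<open>
  The combination of the two extreme rays of the cone in the plane of \<open>(1, 0)\<close> and \<open>(0, w)\<close>; for a
  unit vector \<open>w\<close>, its eigenvalues in the sense of the spin factor Jordan algebra are \<open>2 \<alpha>\<close> and \<open>2 \<beta>\<close>.
\<close>

definition spectral_comb :: "real \<Rightarrow> real \<Rightarrow> (nat \<Rightarrow> real) \<Rightarrow> nat \<Rightarrow> real"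
  where "spectral_comb \<alpha> \<beta> w =
    (\<lambda>i. \<alpha> * case_nat 1 (\<lambda>k. - w k) i + \<beta> * case_nat 1 w i)"

lemma spectral_comb_0 [simp]: "spectral_comb \<alpha> \<beta> w 0 = \<alpha> + \<beta>"
  and spectral_comb_Suc [simp]: "spectral_comb \<alpha> \<beta> w (Suc k) = (\<beta> - \<alpha>) * w k"
  by (simp_all add: spectral_comb_def algebra_simps)

lemma hat_spectral_comb: "hat (spectral_comb \<alpha> \<beta> w) = (\<lambda>k. (\<beta> - \<alpha>) * w k)"
  by (simp add: hat_def)

lemma spectral_comb_in_Rvec:
  assumes "w \<in> Rvec (m - 1)" "m \<ge> 1"
  shows "spectral_comb \<alpha> \<beta> w \<in> Rvec m"
  unfolding topspace_Euclidean_space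
proof (intro CollectI allI impI)
  fix i assume "i \<ge> m"
  then obtain k where "i = Suc k" "k \<ge> m - 1"
    using \<open>m \<ge> 1\<close> by (cases i) auto
  then show "spectral_comb \<alpha> \<beta> w i = 0"
    using assms by (simp add: topspace_Euclidean_space)
qed

text \<open>Membership in the cone reads \<open>\<bar>\<beta> - \<alpha>\<bar> \<le> \<alpha> + \<beta>\<close>.\<close>

lemma spectral_comb_in_soc_iff:
  assumes "w \<in> Rvec (m - 1)" "m \<ge> 1" "enorm (m - 1) w = 1"
  shows "spectral_comb \<alpha> \<beta> w \<in> soc m \<longleftrightarrow> \<alpha> \<ge> 0 \<and> \<beta> \<ge> 0"
  using assms spectral_comb_in_Rvec[OF assms(1,2)]
  by (auto simp: soc_def hat_spectral_comb enorm_scale)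

lemma spectral_comb_eq_0_iff:
  assumes "enorm m w = 1"
  shows "spectral_comb \<alpha> \<beta> w = (\<lambda>_. 0) \<longleftrightarrow> \<alpha> = 0 \<and> \<beta> = 0"
proof
  assume eq: "spectral_comb \<alpha> \<beta> w = (\<lambda>_. 0)"
  have "\<alpha> + \<beta> = 0"
    using fun_cong[OF eq, of 0] by simp
  moreover have "\<bar>\<beta> - \<alpha>\<bar> * enorm m w = 0"
    by (simp add: eq hat_def L2_set_eq_0_iff flip: enorm_scale hat_spectral_comb)
  ultimately show "\<alpha> = 0 \<and> \<beta> = 0"
    using assms by simp
qed (simp add: spectral_comb_def)

text \<open>
  The dimension has to be at least two, so that a unit vector exists when the tail vanishes; then any
  unit vector does, and the first coordinate vector is used.
\<close>

lemma spectral_decomposition: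
  assumes v: "v \<in> Rvec m" and m: "m \<ge> 2"
  obtains w \<alpha> \<beta> where "w \<in> Rvec (m - 1)" "enorm (m - 1) w = 1" "v = spectral_comb \<alpha> \<beta> w"
proof -
  define r where "r = enorm (m - 1) (hat v)"
  have "\<exists>w \<in> Rvec (m - 1). enorm (m - 1) w = 1 \<and> hat v = (\<lambda>k. r * w k)"
  proof (cases "r = 0")
    case True
    have "enorm (m - 1) (\<lambda>k. if k = 0 then 1 else 0) = 1"
      using m by (simp add: L2_set_def if_distrib[of "\<lambda>x. x ^ 2"] sum.delta cong: if_cong)
    moreover have "hat v = (\<lambda>_. 0)"
      using True enorm_eq_0_iff[OF hat_in_Rvec[OF v]] by (simp add: r_def)
    ultimately show ?thesis
      using True m by (intro bexI[of _ "\<lambda>k. if k = 0 then 1 else 0"])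
        (auto simp: topspace_Euclidean_space)
  next
    case False
    moreover have "r \<ge> 0"
      by (simp add: r_def L2_set_nonneg)
    ultimately show ?thesis
      using hat_in_Rvec[OF v] enorm_scale[of "1 / r" "hat v" "m - 1"]
      by (intro bexI[of _ "\<lambda>k. 1 / r * hat v k"])
         (auto simp: topspace_Euclidean_space simp del: One_nat_def simp flip: r_def)
  qed
  then obtain w where w: "w \<in> Rvec (m - 1)" "enorm (m - 1) w = 1" "hat v = (\<lambda>k. r * w k)"
    by blast
  have "v i = spectral_comb ((v 0 - r) / 2) ((v 0 + r) / 2) w i" for i
  proof (cases i)
    case (Suc k)
    have "v (Suc k) = r * w k"
      using fun_cong[OF w(3), of k] by (simp add: hat_def)
    with Suc show ?thesis by (simp add: field_simps)
  qed (simp add: field_simps)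
  then show ?thesis
    using that w by blast
qed

section \<open>The boundary of the cone\<close>

lemma continuous_map_coordinate:
  "continuous_map (Euclidean_space m) euclideanreal (\<lambda>y. y i)"
  unfolding Euclidean_space_def
  by (intro continuous_map_from_subtopology continuous_map_product_projection) simp

lemma openin_soc_strict:
  "openin (Euclidean_space m) {y \<in> Rvec m. y 0 - enorm (m - 1) (hat y) > 0}"
proof -
  have "continuous_map (Euclidean_space m) euclideanreal (\<lambda>y. y 0 - enorm (m - 1) (hat y))"
    unfolding L2_set_def hat_def
    by (intro continuous_map_diff continuous_map_sqrt continuous_map_sum
        continuous_map_real_pow continuous_map_coordinate finite_lessThan)
  then have "openin (Euclidean_space m)
      {y \<in> Rvec m. y 0 - enorm (m - 1) (hat y) \<in> {0<..}}"
    by (rule openin_continuous_map_preimage) simp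
  then show ?thesis by simp
qed

text \<open>
  A point of the cone with \<open>y\<^sub>0 > \<parallel>hat y\<parallel>\<close> is interior, hence not on the frontier; so the cone
  inequality is an equality on the boundary. If \<open>y\<^sub>0\<close> vanished too, so would the tail.
\<close>

lemma bd_plus_soc_imp:
  assumes "y \<in> bd_plus_soc m" "y \<in> soc m"
  shows "y 0 = enorm (m - 1) (hat y)" and "y 0 > 0"
proof -
  have "{y \<in> Rvec m. y 0 - enorm (m - 1) (hat y) > 0} \<subseteq> Euclidean_space m interior_of soc m"
    by (intro interior_of_maximal openin_soc_strict) (auto simp: soc_def)
  moreover have "y \<notin> Euclidean_space m interior_of soc m"
    using assms(1) by (simp add: bd_plus_soc_def frontier_of_def)
  ultimately show eq: "y 0 = enorm (m - 1) (hat y)"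
    using assms(2) by (fastforce simp: soc_def)
  have y: "y \<in> Rvec m" "y \<noteq> (\<lambda>_. 0)"
    using assms by (auto simp: soc_def bd_plus_soc_def)
  have "y 0 \<noteq> 0"
  proof
    assume y0: "y 0 = 0"
    then have "hat y = (\<lambda>_. 0)"
      using eq enorm_eq_0_iff[OF hat_in_Rvec[OF y(1)]] by simp
    then have "y i = 0" for i
      using y0 by (cases i) (auto simp: hat_def fun_eq_iff)
    then show False
      using y(2) by auto
  qed
  then show "y 0 > 0"
    using eq by (simp add: L2_set_nonneg less_le)
qed

lemma mat_vec_Gamma:
  "mat_vec m Gamma y i = (if i < m then if i = 0 then y 0 else - y i else 0)"
proof -
  have "(\<Sum>k<m. Gamma i k * y k) = (\<Sum>k<m. if i = k then Gamma i i * y i else 0)"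
    by (intro sum.cong) (auto simp: Gamma_def)
  then show ?thesis
    by (simp add: mat_vec_def Gamma_def)
qed

lemma Gamma_eq_scaled_u1:
  assumes "y \<in> bd_plus_soc m" "y \<in> soc m" "i < m"
  shows "mat_vec m Gamma y i = 2 * y 0 * u1 m y i"
  using bd_plus_soc_imp[OF assms(1,2)] assms(3)
  by (cases i) (auto simp: mat_vec_Gamma u1_def hat_def)

section \<open>Combinations of the family as instances of equation (E)\<close>

lemma JacT_vec_cong:
  "(\<And>i. i < m \<Longrightarrow> v i = v' i) \<Longrightarrow> JacT_vec m h x v = JacT_vec m h x v'"
  by (simp add: JacT_vec_def)

lemma JacT_vec_scale: "JacT_vec m h x (\<lambda>i. c * v i) = c *\<^sub>R JacT_vec m h x v"
  by (simp add: JacT_vec_def vec_eq_iff sum_distrib_left mult_ac)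

lemma JacT_vec_add:
  "JacT_vec m h x (\<lambda>i. v i + v' i) = JacT_vec m h x v + JacT_vec m h x v'"
  by (simp add: JacT_vec_def vec_eq_iff sum.distrib algebra_simps)

lemma JacT_vec_spectral_comb:
  "JacT_vec m h x (spectral_comb \<alpha> \<beta> w) =
    \<alpha> *\<^sub>R JacT_vec m h x (case_nat 1 (\<lambda>k. - w k)) + \<beta> *\<^sub>R JacT_vec m h x (case_nat 1 w)"
  unfolding spectral_comb_def by (simp only: JacT_vec_add JacT_vec_scale)

lemma finite_I0 [simp]: "finite (I0 q g x)" and finite_IB [simp]: "finite (IB q m g x)"
  by (simp_all add: I0_def IB_def)

lemma sum_fam_index_set:
  "(\<Sum>i\<in>fam_index_set q m g x. F i) =
    (\<Sum>j\<in>IB q m g x. F (Bdry j)) + (\<Sum>j\<in>I0 q g x. F (Minus j) + F (Plus j))"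
proof -
  have "(\<Sum>i\<in>fam_index_set q m g x. F i) =
      sum F (Bdry ` IB q m g x) + (sum F (Minus ` I0 q g x) + sum F (Plus ` I0 q g x))"
    unfolding fam_index_set_def
    by (subst sum.union_disjoint; (subst sum.union_disjoint)?) auto
  then show ?thesis
    by (simp add: sum.reindex inj_on_def sum.distrib)
qed

text \<open>
  The dictionary between the two kinds of coefficients: \<open>c (Bdry j)\<close> absorbs the factor \<open>2 y\<^sub>0\<close>
  relating \<open>\<Gamma> y\<close> to \<open>u\<^sub>1(y)\<close>, and \<open>v j\<close> has spectral coefficients \<open>c (Minus j)\<close>, \<open>c (Plus j)\<close>.
\<close>

lemma equation_E_iff_fam_sum_0:
  assumes feas: "feasible q m g x"
    and c: "\<And>j. j \<in> IB q m g x \<Longrightarrow> c (Bdry j) = 2 * g j x 0 * a j"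
    and v: "\<And>j. j \<in> I0 q g x \<Longrightarrow> v j = spectral_comb (c (Minus j)) (c (Plus j)) (w j)"
  shows "equation_E q m g x a v \<longleftrightarrow>
    (\<Sum>i\<in>fam_index_set q m g x. c i *\<^sub>R fam m g x w i) = 0"
proof -
  have "a j *\<^sub>R JacT_vec (m j) (g j) x (mat_vec (m j) Gamma (g j x)) =
      c (Bdry j) *\<^sub>R JacT_vec (m j) (g j) x (u1 (m j) (g j x))" if "j \<in> IB q m g x" for j
  proof -
    have "g j x \<in> bd_plus_soc (m j)" "g j x \<in> soc (m j)"
      using that feas by (auto simp: IB_def feasible_def)
    then have "JacT_vec (m j) (g j) x (mat_vec (m j) Gamma (g j x)) =
        JacT_vec (m j) (g j) x (\<lambda>i. 2 * g j x 0 * u1 (m j) (g j x) i)"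
      by (intro JacT_vec_cong Gamma_eq_scaled_u1)
    then show ?thesis
      using c[OF that] by (simp add: JacT_vec_scale)
  qed
  moreover have "JacT_vec (m j) (g j) x (v j) =
      c (Minus j) *\<^sub>R JacT_vec (m j) (g j) x (case_nat 1 (\<lambda>k. - w j k)) +
      c (Plus j) *\<^sub>R JacT_vec (m j) (g j) x (case_nat 1 (w j))" if "j \<in> I0 q g x" for j
    using v[OF that] by (simp add: JacT_vec_spectral_comb)
  ultimately show ?thesis
    unfolding equation_E_def sum_fam_index_set by simp
qed

text \<open>
  Passing from (E) to the family uses that each \<open>v j\<close> decomposes spectrally with coefficients in \<open>K\<close>;
  passing back uses that such combinations lie in \<open>C\<close>. Both directions rescale the coefficients of
  \<open>I\<^sub>B\<close> by a positive number, so \<open>K\<close> is taken closed under positive scaling.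
\<close>

lemma only_trivial_solution_iff:
  fixes C :: "nat \<Rightarrow> (nat \<Rightarrow> real) set" and K :: "real set"
  assumes prob: "nsocp f q m g" and feas: "feasible q m g x"
    and K_scale: "\<And>r t. r > 0 \<Longrightarrow> t \<in> K \<Longrightarrow> r * t \<in> K"
    and C_Rvec: "\<And>n. C n \<subseteq> Rvec n"
    and C_iff: "\<And>n w \<alpha> \<beta>. n \<ge> 2 \<Longrightarrow> w \<in> Rvec (n - 1) \<Longrightarrow> enorm (n - 1) w = 1 \<Longrightarrow>
      spectral_comb \<alpha> \<beta> w \<in> C n \<longleftrightarrow> \<alpha> \<in> K \<and> \<beta> \<in> K"
  shows "(\<forall>a v. (\<forall>j\<in>IB q m g x. a j \<in> K) \<longrightarrow> (\<forall>j\<in>I0 q g x. v j \<in> C (m j)) \<longrightarrow>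
            equation_E q m g x a v \<longrightarrow>
            (\<forall>j\<in>IB q m g x. a j = 0) \<and> (\<forall>j\<in>I0 q g x. v j = (\<lambda>_. 0))) \<longleftrightarrow>
         (\<forall>w. unit_choice q m g x w \<longrightarrow>
            (\<forall>c. (\<forall>i\<in>fam_index_set q m g x. c i \<in> K) \<longrightarrow>
              (\<Sum>i\<in>fam_index_set q m g x. c i *\<^sub>R fam m g x w i) = 0 \<longrightarrow>
              (\<forall>i\<in>fam_index_set q m g x. c i = 0)))"
    (is "?E \<longleftrightarrow> ?F")
proof
  have pos: "g j x 0 > 0" if "j \<in> IB q m g x" for j
    using that feas bd_plus_soc_imp(2) by (auto simp: IB_def feasible_def)
  have dim: "m j \<ge> 2" if "j \<in> I0 q g x" for j
    using that prob by (auto simp: I0_def nsocp_def)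
  show ?F if E: ?E
  proof (intro allI impI)
    fix w c
    assume w: "unit_choice q m g x w"
      and cK: "\<forall>i\<in>fam_index_set q m g x. c i \<in> K"
      and sum: "(\<Sum>i\<in>fam_index_set q m g x. c i *\<^sub>R fam m g x w i) = 0"
    define a where "a j = 1 / (2 * g j x 0) * c (Bdry j)" for j
    define v where "v j = spectral_comb (c (Minus j)) (c (Plus j)) (w j)" for j
    have ca: "c (Bdry j) = 2 * g j x 0 * a j" if "j \<in> IB q m g x" for j
      using pos[OF that] by (simp add: a_def)
    have "equation_E q m g x a v"
      using equation_E_iff_fam_sum_0[of q m g x c a v w, OF feas ca] sum by (simp add: v_def)
    moreover have "a j \<in> K" if "j \<in> IB q m g x" for j
      using K_scale[of "1 / (2 * g j x 0)" "c (Bdry j)"] pos[OF that] that cK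
      by (simp add: a_def fam_index_set_def)
    moreover have "v j \<in> C (m j)" if "j \<in> I0 q g x" for j
      using C_iff[OF dim[OF that]] that w cK
      by (auto simp: v_def unit_choice_def fam_index_set_def)
    ultimately have a0: "\<forall>j\<in>IB q m g x. a j = 0" and v0: "\<forall>j\<in>I0 q g x. v j = (\<lambda>_. 0)"
      using E by blast+
    have "c (Minus j) = 0 \<and> c (Plus j) = 0" if "j \<in> I0 q g x" for j
      using v0 that w spectral_comb_eq_0_iff[of "w j" "m j - 1"]
      unfolding v_def unit_choice_def by metis
    then show "\<forall>i\<in>fam_index_set q m g x. c i = 0"
      using a0 ca by (auto simp: fam_index_set_def)
  qed
  show ?E if F: ?F
  proof (intro allI impI)
    fix a v
    assume aK: "\<forall>j\<in>IB q m g x. a j \<in> K" and vC: "\<forall>j\<in>I0 q g x. v j \<in> C (m j)"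
      and E: "equation_E q m g x a v"
    have "\<forall>j\<in>I0 q g x. \<exists>w \<alpha> \<beta>. w \<in> Rvec (m j - 1) \<and> enorm (m j - 1) w = 1 \<and>
        v j = spectral_comb \<alpha> \<beta> w"
      using vC C_Rvec dim by (metis spectral_decomposition subsetD)
    then obtain w \<alpha> \<beta> where w: "\<forall>j\<in>I0 q g x. w j \<in> Rvec (m j - 1) \<and> enorm (m j - 1) (w j) = 1 \<and>
        v j = spectral_comb (\<alpha> j) (\<beta> j) (w j)"
      by metis
    define c where "c i = (case i of Bdry j \<Rightarrow> 2 * g j x 0 * a j | Minus j \<Rightarrow> \<alpha> j | Plus j \<Rightarrow> \<beta> j)"
      for i
    have "unit_choice q m g x w"
      using w by (simp add: unit_choice_def)
    moreover have "(\<Sum>i\<in>fam_index_set q m g x. c i *\<^sub>R fam m g x w i) = 0"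
      using equation_E_iff_fam_sum_0[of q m g x c a v w] feas E w by (simp add: c_def)
    moreover have "\<alpha> j \<in> K \<and> \<beta> j \<in> K" if "j \<in> I0 q g x" for j
      using C_iff[OF dim[OF that], of "w j" "\<alpha> j" "\<beta> j"] that w vC by metis
    then have "\<forall>i\<in>fam_index_set q m g x. c i \<in> K"
      using aK pos K_scale by (auto simp: c_def fam_index_set_def)
    ultimately have c0: "c i = 0" if "i \<in> fam_index_set q m g x" for i
      using F that by blast
    have "a j = 0" if "j \<in> IB q m g x" for j
      using c0[of "Bdry j"] that pos[OF that] by (simp add: fam_index_set_def c_def)
    moreover have "v j = (\<lambda>_. 0)" if "j \<in> I0 q g x" for j
      using c0[of "Minus j"] c0[of "Plus j"] that w
      by (simp add: fam_index_set_def c_def spectral_comb_def)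
    ultimately show "(\<forall>j\<in>IB q m g x. a j = 0) \<and> (\<forall>j\<in>I0 q g x. v j = (\<lambda>_. 0))"
      by blast
  qed
qed

theorem corollary3p1:
  fixes f :: "real^'n \<Rightarrow> real"
    and q :: nat
    and m :: "nat \<Rightarrow> nat"
    and g :: "nat \<Rightarrow> real^'n \<Rightarrow> nat \<Rightarrow> real"
    and xbar :: "real^'n"
  assumes "nsocp f q m g"
    and "feasible q m g xbar"
  shows "(nondegenerate q m g xbar \<longleftrightarrow>
           (\<forall>w. unit_choice q m g xbar w \<longrightarrow>
              lin_indep_family (fam_index_set q m g xbar) (fam m g xbar w))) \<and>
         (robinson_cq q m g xbar \<longleftrightarrow>
           (\<forall>w. unit_choice q m g xbar w \<longrightarrow>
              pos_lin_indep_family (fam_index_set q m g xbar) (fam m g xbar w)))"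
proof
  have "spectral_comb \<alpha> \<beta> w \<in> Rvec n" if "n \<ge> 2" "w \<in> Rvec (n - 1)" for n w \<alpha> \<beta>
    using spectral_comb_in_Rvec that by simp
  then show "nondegenerate q m g xbar \<longleftrightarrow>
      (\<forall>w. unit_choice q m g xbar w \<longrightarrow>
        lin_indep_family (fam_index_set q m g xbar) (fam m g xbar w))"
    using only_trivial_solution_iff[OF assms, of UNIV Rvec]
    unfolding nondegenerate_def lin_indep_family_def by simp
  have "soc n \<subseteq> Rvec n" for n
    by (auto simp: soc_def)
  moreover have "spectral_comb \<alpha> \<beta> w \<in> soc n \<longleftrightarrow> \<alpha> \<in> {0..} \<and> \<beta> \<in> {0..}"
    if "n \<ge> 2" "w \<in> Rvec (n - 1)" "enorm (n - 1) w = 1" for n w \<alpha> \<beta>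
    using spectral_comb_in_soc_iff that by simp
  ultimately have "robinson_cq q m g xbar \<longleftrightarrow>
      (\<forall>w. unit_choice q m g xbar w \<longrightarrow>
        (\<forall>c. (\<forall>i\<in>fam_index_set q m g xbar. c i \<in> {0..}) \<longrightarrow>
          (\<Sum>i\<in>fam_index_set q m g xbar. c i *\<^sub>R fam m g xbar w i) = 0 \<longrightarrow>
          (\<forall>i\<in>fam_index_set q m g xbar. c i = 0)))"
    using only_trivial_solution_iff[OF assms, of "{0..}" soc]
    unfolding robinson_cq_def by simp
  then show "robinson_cq q m g xbar \<longleftrightarrow>
      (\<forall>w. unit_choice q m g xbar w \<longrightarrow>
        pos_lin_indep_family (fam_index_set q m g xbar) (fam m g xbar w))"
    unfolding pos_lin_indep_family_def atLeast_iff by blast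
qed

end
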